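(* Let $B_1,\dots,B_T$ be a finite sequence of batches with means $\bm{\mu}(B_s)\in\mathbb{R}^n$, partitioned into $M$ mutually exclusive nonempty clusters $G^1,\dots,G^M$. Assume the clusters are well-separated: there exists $\theta>0$ such that $$\operatorname{diam}(\operatorname{Conv}(G^i)) < \theta < d(\operatorname{Conv}(G^i),\operatorname{Conv}(G^j)) \quad\text{for all } i\neq j .$$ Run the coreset algorithm (described in the context) with threshold $\theta$ on $B_1,\dots,B_T$ in this order. Then for every $t$ with $1\le t\le T$, the algorithm assigns all of the batches $B_1,\dots,B_t$ to the correct clusters.
   Context: Distances: $d$ is the Euclidean distance on $\mathbb{R}^n$; each batch $B$ has a mean vector $\bm{\mu}(B)\in\mathbb{R}^n$ (the mean of its features). For a cluster $G$, $\operatorname{Conv}(G)$ is the convex hull in $\mathbb{R}^n$ of the means $\{\bm{\mu}(B): B\in G\}$. For sets $S,S'$: $\operatorname{diam}(S)=\sup_{x,x'\in S}d(x,x')$ and $d(S,S')=\inf_{x\in S,x'\in S'}d(x,x')$. The algorithm: It maintains a list (coreset) of core elements, initially empty. Each core element $j$ stores a core mean $\bm{\mu}^j\in\mathbb{R}^n$ and a core prompt $\bm{p}^j$ (a parameter vector; prompts play no role in the decisions about assignment). At each time $t=1,2,\dots$, given batch $B_t$: 1. Compute $d^j=d(\bm{\mu}(B_t),\bm{\mu}^j)$ for all existing core elements $j$. 2. If the coreset is empty or $\min_j d^j>\theta$: create a new core element with mean $\bm{\mu}(B_t)$ and a prompt learned from scratch on $B_t$; $B_t$ is assigned to this new core element.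 3. Otherwise: assign $B_t$ to the closest core element $j^*=\arg\min_j d^j$, replace its prompt by an updated prompt, and update its mean by $$\bm{\mu}^{j^*}\leftarrow(1-\alpha)\,\bm{\mu}^{j^*}+\alpha\,\bm{\mu}(B_t).$$ All other core elements are unchanged. Here $\alpha\in[0,1]$ is the updating weight (it may depend on the step). "All batches $B_1,\dots,B_t$ are assigned to correct clusters" means: for all $r,s\le t$, the batches $B_r$ and $B_s$ are assigned to the same core element if and only if they belong to the same cluster $G^i$. *)

theory Defs
  imports "HOL-Analysis.Analysis"
begin

record ('n, 'p) core_element =
  core_mean :: "real ^ 'n"
  core_prompt :: 'p

definition conv_cluster :: "('b \<Rightarrow> real ^ 'n) \<Rightarrow> 'b set \<Rightarrow> (real ^ 'n) set" where
  "conv_cluster \<mu> G = convex hull (\<mu> ` G)"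

definition core_dist ::
  "('b \<Rightarrow> real ^ 'n) \<Rightarrow> ('n, 'p) core_element list \<Rightarrow> 'b \<Rightarrow> nat \<Rightarrow> real" where
  "core_dist \<mu> cs b j = dist (\<mu> b) (core_mean (cs ! j))"

text \<open>
  The coreset is a list, and core elements are identified by their position in it; elements are
  only appended or updated in place, so a position denotes the same core element throughout a run.
  In \<open>coreset_step \<mu> learn update \<theta> \<alpha> cs b j cs'\<close> the batch \<open>b\<close> is assigned
  to the core element \<open>j\<close> and the coreset changes from \<open>cs\<close> to \<open>cs'\<close>. It is a
  relation because any closest core element may be chosen when there are ties.
\<close>

inductive coreset_step ::
  "('b \<Rightarrow> real ^ 'n) \<Rightarrow> ('b \<Rightarrow> 'p) \<Rightarrow> ('p \<Rightarrow> 'b \<Rightarrow> 'p) \<Rightarrow> real \<Rightarrow> real \<Rightarrow>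
   ('n, 'p) core_element list \<Rightarrow> 'b \<Rightarrow> nat \<Rightarrow> ('n, 'p) core_element list \<Rightarrow> bool"
  for \<mu> :: "'b \<Rightarrow> real ^ 'n" and learn :: "'b \<Rightarrow> 'p" and update :: "'p \<Rightarrow> 'b \<Rightarrow> 'p"
    and \<theta> \<alpha> :: real
where
  new_core:
    "cs = [] \<or> Min (core_dist \<mu> cs b ` {..<length cs}) > \<theta> \<Longrightarrow>
     coreset_step \<mu> learn update \<theta> \<alpha> cs b (length cs)
       (cs @ [\<lparr>core_mean = \<mu> b, core_prompt = learn b\<rparr>])"
| closest_core:
    "cs \<noteq> [] \<Longrightarrow> Min (core_dist \<mu> cs b ` {..<length cs}) \<le> \<theta> \<Longrightarrow>
     is_arg_min (core_dist \<mu> cs b) (\<lambda>j. j < length cs) j \<Longrightarrow>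
     coreset_step \<mu> learn update \<theta> \<alpha> cs b j
       (cs[j := \<lparr>core_mean = (1 - \<alpha>) *\<^sub>R core_mean (cs ! j) + \<alpha> *\<^sub>R \<mu> b,
                 core_prompt = update (core_prompt (cs ! j)) b\<rparr>])"

text \<open>
  \<open>C t\<close> is the coreset after batch \<open>B t\<close> has been processed and \<open>a t\<close> is the core element
  to which \<open>B t\<close> is assigned. The prompt functions and the weight may vary with the step.
\<close>

definition coreset_run ::
  "('b \<Rightarrow> real ^ 'n) \<Rightarrow> (nat \<Rightarrow> 'b \<Rightarrow> 'p) \<Rightarrow> (nat \<Rightarrow> 'p \<Rightarrow> 'b \<Rightarrow> 'p) \<Rightarrow> real \<Rightarrow> (nat \<Rightarrow> real) \<Rightarrow>
   nat \<Rightarrow> (nat \<Rightarrow> 'b) \<Rightarrow> (nat \<Rightarrow> ('n, 'p) core_element list) \<Rightarrow> (nat \<Rightarrow> nat) \<Rightarrow> bool" where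
  "coreset_run \<mu> learn update \<theta> \<alpha> T B C a \<longleftrightarrow>
     C 0 = [] \<and>
     (\<forall>t\<in>{1..T}.
        coreset_step \<mu> (learn t) (update t) \<theta> (\<alpha> t) (C (t - 1)) (B t) (a t) (C t))"

definition correctly_assigned ::
  "nat \<Rightarrow> (nat \<Rightarrow> 'b set) \<Rightarrow> (nat \<Rightarrow> 'b) \<Rightarrow> (nat \<Rightarrow> nat) \<Rightarrow> nat \<Rightarrow> bool" where
  "correctly_assigned M G B a t \<longleftrightarrow>
     (\<forall>r\<in>{1..t}. \<forall>s\<in>{1..t}. a r = a s \<longleftrightarrow> (\<exists>i\<in>{1..M}. B r \<in> G i \<and> B s \<in> G i))"

end

(*
  At every time each core element carries a cluster label such that its mean lies in the convex hull
  of that cluster and distinct core elements have distinct labels. A batch is then within the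
  diameter, hence closer than \<theta>, of the core element labelled by its own cluster (if there is
  one), and farther than \<theta> from all others. So a new core element is created exactly when no
  core element has the batch's label, and a mean is only ever moved along a segment inside the hull.
*)
theory Submission
  imports Defs
begin

text \<open>Labels are unconstrained at positions beyond the list, so appending an element only
  requires a function update. Injectivity is what later forces batches of one cluster onto one core
  element.\<close>

definition core_labelling ::
  "'i set \<Rightarrow> ('i \<Rightarrow> (real ^ 'n) set) \<Rightarrow> ('n, 'p) core_element list \<Rightarrow> (nat \<Rightarrow> 'i) \<Rightarrow> bool" where
  "core_labelling I K cs \<kappa> \<longleftrightarrow>
     inj_on \<kappa> {..<length cs} \<and> (\<forall>j<length cs. \<kappa> j \<in> I \<and> core_mean (cs ! j) \<in> K (\<kappa> j))"

lemma core_labellingD: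
  assumes "core_labelling I K cs \<kappa>" "j < length cs"
  shows "\<kappa> j \<in> I" "core_mean (cs ! j) \<in> K (\<kappa> j)"
  using assms by (auto simp: core_labelling_def)

lemma core_labelling_append:
  assumes lab: "core_labelling I K cs \<kappa>"
    and i: "i \<in> I" "i \<notin> \<kappa> ` {..<length cs}" "core_mean e \<in> K i"
  shows "core_labelling I K (cs @ [e]) (\<kappa>(length cs := i))"
proof -
  have "inj_on (\<kappa>(length cs := i)) (insert (length cs) {..<length cs})"
    using lab i(2) by (auto simp: core_labelling_def inj_on_def)
  then show ?thesis
    using lab i by (auto simp: core_labelling_def lessThan_Suc nth_append less_Suc_eq)
qed

lemma core_labelling_update:
  assumes "core_labelling I K cs \<kappa>" "core_mean e \<in> K (\<kappa> j)"
  shows "core_labelling I K (cs[j := e]) \<kappa>"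
  unfolding core_labelling_def
proof (intro conjI allI impI)
  fix k assume "k < length (cs[j := e])"
  then show "\<kappa> k \<in> I" "core_mean (cs[j := e] ! k) \<in> K (\<kappa> k)"
    using assms by (cases "k = j"; simp add: core_labelling_def)+
qed (use assms in \<open>simp add: core_labelling_def\<close>)

text \<open>The inductive step, with the hulls abstracted to sets \<open>K i\<close>. Boundedness
  makes \<open>diameter\<close> a genuine bound on distances, as the real supremum over an unbounded
  set carries no information. Old positions keep their labels, so what is known about earlier
  assignments survives the step.\<close>

lemma coreset_step_labelling:
  fixes \<mu> :: "'b \<Rightarrow> real ^ 'n" and cs :: "('n, 'p) core_element list"
  assumes step: "coreset_step \<mu> learn update \<theta> \<alpha> cs b j cs'"
    and lab: "core_labelling I K cs \<kappa>"
    and conv: "\<And>i. i \<in> I \<Longrightarrow> convex (K i)"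
    and bdd: "\<And>i. i \<in> I \<Longrightarrow> bounded (K i)"
    and diam: "\<And>i. i \<in> I \<Longrightarrow> diameter (K i) < \<theta>"
    and sep: "\<And>i k. i \<in> I \<Longrightarrow> k \<in> I \<Longrightarrow> i \<noteq> k \<Longrightarrow> \<theta> < setdist (K i) (K k)"
    and \<alpha>: "0 \<le> \<alpha>" "\<alpha> \<le> 1"
    and i: "i \<in> I" and b: "\<mu> b \<in> K i"
  shows "\<exists>\<kappa>'. core_labelling I K cs' \<kappa>' \<and> (\<forall>k<length cs. \<kappa>' k = \<kappa> k) \<and>
    length cs \<le> length cs' \<and> j < length cs' \<and> \<kappa>' j = i"
proof -
  have near: "core_dist \<mu> cs b k < \<theta>" if "k < length cs" "\<kappa> k = i" for k
    using diameter_bounded_bound[OF bdd[OF i] b, of "core_mean (cs ! k)"]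
      core_labellingD[OF lab that(1)] diam[OF i] that(2)
    by (auto simp: core_dist_def)
  have far: "\<theta> < core_dist \<mu> cs b k" if "k < length cs" "\<kappa> k \<noteq> i" for k
    using sep[OF i core_labellingD(1)[OF lab that(1)]] that(2)
      setdist_le_dist[OF b core_labellingD(2)[OF lab that(1)]]
    by (auto simp: core_dist_def)
  show ?thesis
    using step
  proof cases
    case new_core
    \<comment> \<open>An element labelled \<open>i\<close> would make the coreset nonempty and, by
      \<open>near\<close>, push the minimum below \<theta>, against the condition for creating an
      element.\<close>
    have "i \<notin> \<kappa> ` {..<length cs}"
    proof
      assume "i \<in> \<kappa> ` {..<length cs}"
      then obtain k where k: "k < length cs" "\<kappa> k = i" by auto
      then have "Min (core_dist \<mu> cs b ` {..<length cs}) \<le> core_dist \<mu> cs b k"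
        by (intro Min_le) auto
      with near[OF k] new_core k(1) show False by auto
    qed
    with lab i b have "core_labelling I K cs' (\<kappa>(length cs := i))"
      unfolding new_core by (intro core_labelling_append) auto
    with new_core show ?thesis by (intro exI[of _ "\<kappa>(length cs := i)"]) auto
  next
    case closest_core
    have j: "j < length cs"
      and least: "\<And>k. k < length cs \<Longrightarrow> core_dist \<mu> cs b j \<le> core_dist \<mu> cs b k"
      using closest_core by (auto simp: is_arg_min_linorder)
    \<comment> \<open>The chosen element attains the minimum, which is at most \<theta>, so
      \<open>far\<close> rules out every label but \<open>i\<close>. This holds for any minimiser,
      however ties are broken.\<close>
    have "core_dist \<mu> cs b j \<le> Min (core_dist \<mu> cs b ` {..<length cs})"
      using closest_core(2) least by (intro Min.boundedI) auto
    then have \<kappa>j: "\<kappa> j = i"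
      using closest_core far[OF j] by force
    have "(1 - \<alpha>) *\<^sub>R core_mean (cs ! j) + \<alpha> *\<^sub>R \<mu> b \<in> K i"
      using core_labellingD(2)[OF lab j] \<kappa>j b \<alpha> by (intro convexD[OF conv[OF i]]) auto
    with \<kappa>j have "core_labelling I K cs' \<kappa>"
      unfolding closest_core by (intro core_labelling_update[OF lab]) auto
    with j \<kappa>j closest_core show ?thesis by (intro exI[of _ \<kappa>]) auto
  qed
qed

theorem propositionB1:
  fixes \<mu> :: "'b \<Rightarrow> real ^ 'n"
    and B :: "nat \<Rightarrow> 'b" and T :: nat
    and G :: "nat \<Rightarrow> 'b set" and M :: nat
    and \<theta> :: real and \<alpha> :: "nat \<Rightarrow> real"
    and learn :: "nat \<Rightarrow> 'b \<Rightarrow> 'p" and update :: "nat \<Rightarrow> 'p \<Rightarrow> 'b \<Rightarrow> 'p"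
    and C :: "nat \<Rightarrow> ('n, 'p) core_element list" and a :: "nat \<Rightarrow> nat"
  assumes "(\<Union>i\<in>{1..M}. G i) = B ` {1..T}"
    and "disjoint_family_on G {1..M}"
    and "\<forall>i\<in>{1..M}. G i \<noteq> {}"
    and "\<theta> > 0"
    and "\<forall>i\<in>{1..M}. diameter (conv_cluster \<mu> (G i)) < \<theta>"
    and "\<forall>i\<in>{1..M}. \<forall>j\<in>{1..M}. i \<noteq> j \<longrightarrow>
           \<theta> < setdist (conv_cluster \<mu> (G i)) (conv_cluster \<mu> (G j))"
    and "\<forall>t\<in>{1..T}. 0 \<le> \<alpha> t \<and> \<alpha> t \<le> 1"
    and "coreset_run \<mu> learn update \<theta> \<alpha> T B C a"
  shows "\<forall>t\<in>{1..T}. correctly_assigned M G B a t"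
proof
  fix t assume t: "t \<in> {1..T}"
  note cover = assms(1) and disj = assms(2)
  define K where "K i = conv_cluster \<mu> (G i)" for i
  have step: "coreset_step \<mu> (learn s) (update s) \<theta> (\<alpha> s) (C (s - 1)) (B s) (a s) (C s)"
    if "s \<in> {1..T}" for s
    using assms(8) that by (auto simp: coreset_run_def)
  have conv: "convex (K i)" for i
    by (simp add: K_def conv_cluster_def)
  \<comment> \<open>Each cluster consists of batches of the finite run, and the convex hull of
    finitely many points is bounded.\<close>
  have bdd: "bounded (K i)" if "i \<in> {1..M}" for i
  proof -
    have "G i \<subseteq> B ` {1..T}" using cover that by auto
    then have "finite (G i)" by (rule finite_subset) simp
    then show ?thesis
      by (simp add: K_def conv_cluster_def bounded_convex_hull finite_imp_bounded)
  qed
  \<comment> \<open>The invariant also records that every batch so far lies in the cluster labelling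
    its core element. The induction starts at time 0, where the coreset is empty and any \<kappa>
    works.\<close>
  have "\<exists>\<kappa>. core_labelling {1..M} K (C t) \<kappa> \<and>
          (\<forall>s\<in>{1..t}. a s < length (C t) \<and> B s \<in> G (\<kappa> (a s)))" if "t \<le> T" for t
    using that
  proof (induction t)
    case 0
    then show ?case
      using assms(8) by (simp add: coreset_run_def core_labelling_def)
  next
    case (Suc t)
    then obtain \<kappa> where lab: "core_labelling {1..M} K (C t) \<kappa>"
      and old: "\<And>s. s \<in> {1..t} \<Longrightarrow> a s < length (C t) \<and> B s \<in> G (\<kappa> (a s))"
      by auto
    have Suc_t: "Suc t \<in> {1..T}" using Suc.prems by auto
    then obtain i where i: "i \<in> {1..M}" "B (Suc t) \<in> G i"
      using cover by blast
    then have mem: "\<mu> (B (Suc t)) \<in> K i"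
      by (simp add: K_def conv_cluster_def hull_inc)
    have diam: "diameter (K k) < \<theta>" if "k \<in> {1..M}" for k
      using assms(5) that by (simp add: K_def)
    have sep: "\<theta> < setdist (K k) (K l)" if "k \<in> {1..M}" "l \<in> {1..M}" "k \<noteq> l" for k l
      using assms(6) that by (simp add: K_def)
    have weight: "0 \<le> \<alpha> (Suc t)" "\<alpha> (Suc t) \<le> 1"
      using assms(7) Suc_t by auto
    have "\<exists>\<kappa>'. core_labelling {1..M} K (C (Suc t)) \<kappa>' \<and>
        (\<forall>k<length (C t). \<kappa>' k = \<kappa> k) \<and> length (C t) \<le> length (C (Suc t)) \<and>
        a (Suc t) < length (C (Suc t)) \<and> \<kappa>' (a (Suc t)) = i"
      by (rule coreset_step_labelling[OF step[OF Suc_t, simplified] lab conv bdd diam sep weight i(1) mem])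
    then obtain \<kappa>' where "core_labelling {1..M} K (C (Suc t)) \<kappa>'"
        "\<forall>k<length (C t). \<kappa>' k = \<kappa> k" "length (C t) \<le> length (C (Suc t))"
        "a (Suc t) < length (C (Suc t))" "\<kappa>' (a (Suc t)) = i"
      by blast
    \<comment> \<open>Earlier batches sit at positions below \<open>length (C t)\<close>, where
      \<open>\<kappa>'\<close> agrees with \<kappa>; the new batch sits at a position labelled
      \<open>i\<close>.\<close>
    with old i(2) show ?case
      by (intro exI[of _ \<kappa>']) (force simp: atLeastAtMostSuc_conv)
  qed
  then obtain \<kappa> where lab: "core_labelling {1..M} K (C t) \<kappa>"
    and assigned: "\<And>s. s \<in> {1..t} \<Longrightarrow> a s < length (C t) \<and> B s \<in> G (\<kappa> (a s))"
    using t by (meson atLeastAtMost_iff)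
  show "correctly_assigned M G B a t"
    unfolding correctly_assigned_def
  proof (intro ballI iffI)
    \<comment> \<open>The label of the shared core element is the common cluster.\<close>
    fix r s assume rs: "r \<in> {1..t}" "s \<in> {1..t}" and "a r = a s"
    then show "\<exists>i\<in>{1..M}. B r \<in> G i \<and> B s \<in> G i"
      using assigned[OF rs(1)] assigned[OF rs(2)] core_labellingD(1)[OF lab] by metis
  next
    fix r s assume rs: "r \<in> {1..t}" "s \<in> {1..t}" and "\<exists>i\<in>{1..M}. B r \<in> G i \<and> B s \<in> G i"
    then obtain i where i: "i \<in> {1..M}" "B r \<in> G i" "B s \<in> G i" by blast
    \<comment> \<open>\<open>B q\<close> lies both in \<open>G i\<close> and in the cluster
      labelling its core element, so disjointness identifies the two. Injectivity of \<kappa> then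
      turns equal labels into equal positions.\<close>
    have label: "\<kappa> (a q) = i" if "q \<in> {1..t}" "B q \<in> G i" for q
      using assigned[OF that(1)] core_labellingD(1)[OF lab] that(2) i(1) disj
      unfolding disjoint_family_on_def by blast
    then have "\<kappa> (a r) = \<kappa> (a s)" using rs i by simp
    then show "a r = a s"
      using lab assigned[OF rs(1)] assigned[OF rs(2)]
      by (auto simp: core_labelling_def dest: inj_onD)
  qed
qed

end
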